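(* Let $M$ be a non-metrizable manifold admitting a cytoplasmic (core-thorn) decomposition $M=U\sqcup\bigsqcup_{x\in X}T_x$. Then $M$ has no brush, i.e. every flow on $M$ has a fixed point.
   Context: A manifold is a connected Hausdorff topological manifold, not assumed metrizable. A flow on $M$ is a continuous action $f\colon\mathbb{R}\times M\to M$ of the additive group $\mathbb{R}$; a brush is a flow without stationary points (points fixed by all $f(t,\cdot)$). A cytoplasmic (or core-thorn) decomposition of a manifold $M$ consists of an open Lindelöf subset $U\subset M$ (the core) such that the connected components of $M-U$ form a family $\{T_x\}_{x\in X}$, $M-U=\bigsqcup_{x\in X}T_x$, where each thorn $T_x$ is a one-dimensional manifold-with-boundary having exactly one boundary point, hence homeomorphic either to $\mathbb{R}_{\ge 0}=[0,\infty)$ or to the closed long ray $\mathbb{L}_{\ge 0}$ (the boundary point $x$ is used as the index of the thorn). Moreover the following axiom is required: (CT) each point $z\in T_x$ on a thorn has a fundamental system of open neighbourhoods in $M$ each of which consists of points of the thorn $T_x$ together with a non-empty set of points of the core $U$ (i.e. each is contained in $U\cup T_x$ and meets $U$). The closed long ray $\mathbb{L}_{\ge 0}$ is $\omega_1\times[0,1)$ with the lexicographic order topology. *)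

theory Defs
  imports "HOL-Analysis.Analysis"
begin

(* No metrizability or countability condition. The dimension is left open: a connected locally
   Euclidean space has a constant one, so a single n serves all points. *)
definition manifold :: "'a topology \<Rightarrow> bool" where
  "manifold M \<longleftrightarrow>
     connected_space M \<and> Hausdorff_space M \<and>
     (\<exists>n. \<forall>p\<in>topspace M. \<exists>V W. openin M V \<and> p \<in> V \<and> openin (Euclidean_space n) W \<and>
        subtopology M V homeomorphic_space subtopology (Euclidean_space n) W)"

definition half_line_chart :: "'a topology \<Rightarrow> 'a set \<Rightarrow> ('a \<Rightarrow> real) \<Rightarrow> bool" where
  "half_line_chart N V \<phi> \<longleftrightarrow>
     openin N V \<and>
     (\<exists>W. openin (top_of_set {0..}) W \<and> homeomorphic_map (subtopology N V) (top_of_set W) \<phi>)"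

definition one_manifold_with_boundary :: "'a topology \<Rightarrow> bool" where
  "one_manifold_with_boundary N \<longleftrightarrow>
     connected_space N \<and> Hausdorff_space N \<and>
     (\<forall>p\<in>topspace N. \<exists>V \<phi>. p \<in> V \<and> half_line_chart N V \<phi>)"

definition boundary_points :: "'a topology \<Rightarrow> 'a set" where
  "boundary_points N = {p. \<exists>V \<phi>. p \<in> V \<and> half_line_chart N V \<phi> \<and> \<phi> p = 0}"

(* U is the core and T x, for x in X, are the thorns, each indexed by its own boundary point.
   The last conjunct is axiom (CT), with \<B> the fundamental system of neighbourhoods of z. *)
definition cytoplasmic_decomposition ::
    "'a topology \<Rightarrow> 'a set \<Rightarrow> 'a set \<Rightarrow> ('a \<Rightarrow> 'a set) \<Rightarrow> bool" where
  "cytoplasmic_decomposition M U X T \<longleftrightarrow>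
     openin M U \<and> Lindelof_space (subtopology M U) \<and>
     bij_betw T X (connected_components_of (subtopology M (topspace M - U))) \<and>
     (\<forall>x\<in>X. one_manifold_with_boundary (subtopology M (T x)) \<and>
            boundary_points (subtopology M (T x)) = {x}) \<and>
     (\<forall>x\<in>X. \<forall>z\<in>T x. \<exists>\<B>.
        (\<forall>V\<in>\<B>. openin M V \<and> z \<in> V \<and> V \<subseteq> U \<union> T x \<and> V \<inter> U \<noteq> {}) \<and>
        (\<forall>W. openin M W \<and> z \<in> W \<longrightarrow> (\<exists>V\<in>\<B>. V \<subseteq> W)))"

definition flow :: "'a topology \<Rightarrow> (real \<Rightarrow> 'a \<Rightarrow> 'a) \<Rightarrow> bool" where
  "flow M f \<longleftrightarrow>
     continuous_map (prod_topology euclideanreal M) M (\<lambda>(t, x). f t x) \<and>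
     (\<forall>x\<in>topspace M. f 0 x = x) \<and>
     (\<forall>x\<in>topspace M. \<forall>s t. f (s + t) x = f s (f t x))"

definition stationary_point :: "'a topology \<Rightarrow> (real \<Rightarrow> 'a \<Rightarrow> 'a) \<Rightarrow> 'a \<Rightarrow> bool" where
  "stationary_point M f x \<longleftrightarrow> x \<in> topspace M \<and> (\<forall>t. f t x = x)"

definition brush :: "'a topology \<Rightarrow> (real \<Rightarrow> 'a \<Rightarrow> 'a) \<Rightarrow> bool" where
  "brush M f \<longleftrightarrow> flow M f \<and> (\<nexists>x. stationary_point M f x)"

end

theory Submission
  imports Defs
begin

text \<open>The orbit saturation \<open>S\<close> of the core is open and invariant, and it is still Lindelof, being the
  union of the images of the core at rational times. By Urysohn metrization a Lindelof manifold is
  metrizable, so \<open>S\<close> misses a point of some thorn. An orbit outside \<open>S\<close> is a connected set outside the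
  core, so it never leaves its thorn, and the part \<open>K\<close> of the thorn outside \<open>S\<close> is invariant.
  Take a point of \<open>K\<close> on the frontier of \<open>K\<close> in the thorn, or the boundary point of the thorn if \<open>K\<close> is
  everything: in a chart its orbit stays on one side of it, both in the near past and in the near
  future, and on a line this forces the point to be fixed.\<close>

section \<open>Lindelof manifolds are metrizable\<close>

text \<open>Each pair of basic sets with the closure of one inside the other yields a Urysohn
  function. These countably many functions separate points from closed sets, so together they embed
  \<open>X\<close> in a countable product of real lines, which is metrizable.\<close>

theorem Urysohn_metrization:
  assumes reg: "regular_space X" and haus: "Hausdorff_space X" and sc: "second_countable X"
  shows "metrizable_space X"
proof -
  obtain \<B> where cB: "countable \<B>" and oB: "\<And>V. V \<in> \<B> \<Longrightarrow> openin X V"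
    and bB: "\<And>U x. openin X U \<Longrightarrow> x \<in> U \<Longrightarrow> \<exists>V\<in>\<B>. x \<in> V \<and> V \<subseteq> U"
    using sc unfolding second_countable_def by metis
  have nrm: "normal_space X"
    by (simp add: reg regular_Lindelof_imp_normal_space sc second_countable_imp_Lindelof_space)
  define I where "I = {(V, W). V \<in> \<B> \<and> W \<in> \<B> \<and> X closure_of V \<subseteq> W}"
  have "countable I"
    by (rule countable_subset[of _ "\<B> \<times> \<B>"]) (auto simp: I_def cB)
  have "\<exists>g. continuous_map X euclideanreal g \<and> (\<forall>x\<in>X closure_of fst i. g x = 0) \<and>
            (\<forall>x\<in>topspace X - snd i. g x = 1)" if iI: "i \<in> I" for i
  proof -
    obtain V W where i: "i = (V, W)" "V \<in> \<B>" "W \<in> \<B>" "X closure_of V \<subseteq> W"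
      using iI unfolding I_def by blast
    have "closedin X (X closure_of V)" "closedin X (topspace X - W)"
      "disjnt (X closure_of V) (topspace X - W)"
      using i oB by (auto simp: disjnt_def)
    then obtain g where "continuous_map X (top_of_set {0..1::real}) g"
      "g ` (X closure_of V) \<subseteq> {0}" "g ` (topspace X - W) \<subseteq> {1}"
      using Urysohn_lemma[OF nrm, of "X closure_of V" "topspace X - W" 0 1]
      by (auto simp: image_subset_iff_funcset)
    then show ?thesis
      using i by (intro exI[of _ g]) (auto simp: continuous_map_in_subtopology)
  qed
  then obtain g where g: "\<And>i. i \<in> I \<Longrightarrow> continuous_map X euclideanreal (g i) \<and>
      (\<forall>x\<in>X closure_of fst i. g i x = 0) \<and> (\<forall>x\<in>topspace X - snd i. g i x = 1)"
    by metis
  then have gc: "\<And>i. i \<in> I \<Longrightarrow> continuous_map X euclideanreal (g i)"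
    and g0: "\<And>i x. i \<in> I \<Longrightarrow> x \<in> X closure_of fst i \<Longrightarrow> g i x = 0"
    and g1: "\<And>i x. i \<in> I \<Longrightarrow> x \<in> topspace X \<Longrightarrow> x \<notin> snd i \<Longrightarrow> g i x = 1"
    by (simp_all add: g)
  have sep: "\<exists>i\<in>I. g i x = 0 \<and> (\<forall>y\<in>topspace X - U. g i y = 1)"
    if U: "openin X U" "x \<in> U" for U x
  proof -
    obtain W where W: "W \<in> \<B>" "x \<in> W" "W \<subseteq> U"
      using bB[OF U] by blast
    \<comment> \<open>Regularity inserts a closed neighbourhood \<open>C\<close> of \<open>x\<close>
      into \<open>W\<close>. A basic \<open>V\<close> inside the interior part \<open>G\<close> then
      has its closure in \<open>C\<close>, so the pair \<open>(V, W)\<close> is admissible.\<close>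
    have "neighbourhood_base_of (closedin X) X"
      using reg neighbourhood_base_of_closedin by auto
    then obtain G C where GC: "openin X G" "closedin X C" "x \<in> G" "G \<subseteq> C" "C \<subseteq> W"
      using oB[OF W(1)] W(2) unfolding neighbourhood_base_of by meson
    obtain V where V: "V \<in> \<B>" "x \<in> V" "V \<subseteq> G"
      using bB[OF GC(1) GC(3)] by blast
    have "X closure_of V \<subseteq> W"
      using closure_of_minimal[of V C X] V GC by blast
    then have "(V, W) \<in> I"
      using V W by (simp add: I_def)
    moreover have "x \<in> X closure_of V"
      using closure_of_subset[OF openin_subset[OF oB[OF V(1)]]] V(2) by blast
    moreover have "g (V, W) y = 1" if "y \<in> topspace X - U" for y
      using g1[OF \<open>(V, W) \<in> I\<close>, of y] W(3) that by auto
    ultimately show ?thesis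
      using g0[of "(V, W)" x] by auto
  qed
  define P where "P = product_topology (\<lambda>i. euclideanreal) I"
  define e where "e = (\<lambda>x. \<lambda>i\<in>I. g i x)"
  have metP: "metrizable_space P"
    unfolding P_def metrizable_space_product_topology
    using \<open>countable I\<close> by (auto simp: metrizable_space_euclidean intro: countable_subset)
  have cont: "continuous_map X P e"
    unfolding P_def e_def by (auto simp: continuous_map_componentwise gc)
  have inj: "inj_on e (topspace X)"
  proof (rule inj_onI, rule ccontr)
    fix x y assume xy: "x \<in> topspace X" "y \<in> topspace X" "e x = e y" "x \<noteq> y"
    have "openin X (topspace X - {y})"
      by (simp add: closedin_Hausdorff_singleton haus openin_diff xy)
    then obtain i where "i \<in> I" "g i x = 0" "g i y = 1"
      using sep[of "topspace X - {y}" x] xy by auto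
    then show False
      using fun_cong[OF xy(3), of i] by (simp add: e_def)
  qed
  have opn: "open_map X (subtopology P (e ` topspace X)) e"
    unfolding open_map_def
  proof (intro allI impI)
    fix U assume U: "openin X U"
    show "openin (subtopology P (e ` topspace X)) (e ` U)"
    proof (subst openin_subopen, intro ballI)
      fix y assume "y \<in> e ` U"
      then obtain x where x: "x \<in> U" "y = e x" by blast
      have xX: "x \<in> topspace X" using U x openin_subset by blast
      obtain i where i: "i \<in> I" "g i x = 0" and i1: "\<forall>y\<in>topspace X - U. g i y = 1"
        using sep[OF U x(1)] by blast
      \<comment> \<open>Restricting the single coordinate \<open>i\<close> to values below 1
        suffices: \<open>g i\<close> equals 1 off \<open>U\<close>, so image points in this slab
        come from \<open>U\<close>.\<close>
      have "openin P {z \<in> topspace P. z i \<in> {..<1}}"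
        unfolding P_def
        by (rule openin_continuous_map_preimage[OF continuous_map_product_projection[OF i(1)]]) simp
      then have "openin (subtopology P (e ` topspace X)) (e ` topspace X \<inter> {z \<in> topspace P. z i \<in> {..<1}})"
        by (simp add: openin_subtopology_Int2)
      moreover have "y \<in> e ` topspace X \<inter> {z \<in> topspace P. z i \<in> {..<1}}"
        using x xX i cont by (auto simp: e_def continuous_map_def)
      moreover have "e ` topspace X \<inter> {z \<in> topspace P. z i \<in> {..<1}} \<subseteq> e ` U"
      proof
        fix z assume "z \<in> e ` topspace X \<inter> {z \<in> topspace P. z i \<in> {..<1}}"
        then obtain w where w: "w \<in> topspace X" "z = e w" "z i < 1" by auto
        then have "g i w < 1" using i by (simp add: e_def)
        then have "w \<in> U" using i1 w by force
        then show "z \<in> e ` U" using w by blast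
      qed
      ultimately show "\<exists>T. openin (subtopology P (e ` topspace X)) T \<and> y \<in> T \<and> T \<subseteq> e ` U"
        by blast
    qed
  qed
  have "continuous_map X (subtopology P (e ` topspace X)) e"
    using cont by (simp add: continuous_map_in_subtopology)
  moreover have "e ` topspace X = topspace (subtopology P (e ` topspace X))"
    using continuous_map_image_subset_topspace[OF cont] by auto
  ultimately have "homeomorphic_map X (subtopology P (e ` topspace X)) e"
    using bijective_open_imp_homeomorphic_map opn inj by blast
  then show ?thesis
    using metP homeomorphic_metrizable_space homeomorphic_map_imp_homeomorphic_space
      metrizable_space_subtopology by metis
qed

section \<open>From the Lindelof property to second countability and metrizability\<close>

lemma second_countable_Euclidean_space: "second_countable (Euclidean_space n)"
proof -
  obtain \<B> :: "(nat \<Rightarrow> real) set set" where "countable \<B>" "topological_basis \<B>"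
    using ex_countable_basis by blast
  then have "second_countable (euclidean :: (nat \<Rightarrow> real) topology)"
    unfolding second_countable_def open_openin[symmetric]
    by (metis topological_basisE topological_basis_open)
  then show ?thesis
    by (simp add: Euclidean_space_def euclidean_product_topology second_countable_subtopology)
qed

text \<open>Countably many second countable open patches cover the space. Since the patches are
  open, the union of their countable bases is a base of the whole space.\<close>

lemma Lindelof_locally_second_countable_imp_second_countable:
  assumes "Lindelof_space X"
    and loc: "\<And>p. p \<in> topspace X \<Longrightarrow> \<exists>V. openin X V \<and> p \<in> V \<and> second_countable (subtopology X V)"
  shows "second_countable X"
proof -
  obtain N where N: "\<And>p. p \<in> topspace X \<Longrightarrow>
      openin X (N p) \<and> p \<in> N p \<and> second_countable (subtopology X (N p))"
    using loc by metis
  have cover: "\<Union> (N ` topspace X) = topspace X"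
    using N openin_subset by fastforce
  have "\<exists>\<V>. countable \<V> \<and> \<V> \<subseteq> N ` topspace X \<and> \<Union>\<V> = topspace X"
    by (rule Lindelof_spaceD[OF assms(1) _ cover]) (use N in auto)
  then obtain \<V> where \<V>: "countable \<V>" "\<V> \<subseteq> N ` topspace X" "\<Union>\<V> = topspace X"
    by metis
  then have "\<And>V. V \<in> \<V> \<Longrightarrow> second_countable (subtopology X V)" and oV: "\<And>V. V \<in> \<V> \<Longrightarrow> openin X V"
    using N by auto
  then have "\<exists>\<B>. countable \<B> \<and> (\<forall>B\<in>\<B>. openin (subtopology X V) B) \<and>
      (\<forall>U x. openin (subtopology X V) U \<and> x \<in> U \<longrightarrow> (\<exists>B\<in>\<B>. x \<in> B \<and> B \<subseteq> U))" if "V \<in> \<V>" for V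
    using that unfolding second_countable_def by blast
  then obtain B where B: "\<And>V. V \<in> \<V> \<Longrightarrow> countable (B V)"
    "\<And>V G. V \<in> \<V> \<Longrightarrow> G \<in> B V \<Longrightarrow> openin (subtopology X V) G"
    "\<And>V U x. V \<in> \<V> \<Longrightarrow> openin (subtopology X V) U \<Longrightarrow> x \<in> U \<Longrightarrow> \<exists>G\<in>B V. x \<in> G \<and> G \<subseteq> U"
    by metis
  show ?thesis
    unfolding second_countable_def
  proof (intro exI[of _ "\<Union> (B ` \<V>)"] conjI ballI allI impI)
    show "countable (\<Union> (B ` \<V>))"
      using \<V> B by auto
    show "openin X G" if "G \<in> \<Union> (B ` \<V>)" for G
      using that B(2) oV by (metis UN_E openin_open_subtopology)
    fix U x assume Ux: "openin X U \<and> x \<in> U"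
    then obtain V where V: "V \<in> \<V>" "x \<in> V"
      using \<V>(3) openin_subset by blast
    then have "openin (subtopology X V) (V \<inter> U)"
      using Ux by (simp add: openin_subtopology_Int2)
    then obtain G where "G \<in> B V" "x \<in> G" "G \<subseteq> V \<inter> U"
      using B(3) V Ux by (meson IntI)
    then show "\<exists>G\<in>\<Union> (B ` \<V>). x \<in> G \<and> G \<subseteq> U"
      using V by blast
  qed
qed

text \<open>The charts supply second countability locally, and the Lindelof property makes it
  global. They also give local compactness, which with the Hausdorff property yields the regularity
  needed for Urysohn metrization.\<close>

lemma Lindelof_manifold_metrizable:
  assumes "manifold M" "Lindelof_space M"
  shows "metrizable_space M"
proof -
  obtain n where n: "\<And>p. p \<in> topspace M \<Longrightarrow> \<exists>V W. openin M V \<and> p \<in> V \<and> openin (Euclidean_space n) W \<and>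
        subtopology M V homeomorphic_space subtopology (Euclidean_space n) W"
    and haus: "Hausdorff_space M"
    using assms(1) unfolding manifold_def by blast
  have "second_countable M"
  proof (rule Lindelof_locally_second_countable_imp_second_countable[OF assms(2)])
    fix p assume "p \<in> topspace M"
    then show "\<exists>V. openin M V \<and> p \<in> V \<and> second_countable (subtopology M V)"
      using n[of p] homeomorphic_space_second_countability second_countable_subtopology
        second_countable_Euclidean_space by metis
  qed
  moreover have "locally_compact_space M"
    unfolding locally_compact_space_def
  proof
    fix p assume "p \<in> topspace M"
    then obtain V W where VW: "openin M V" "p \<in> V" "openin (Euclidean_space n) W"
      "subtopology M V homeomorphic_space subtopology (Euclidean_space n) W"
      using n by blast
    have "locally_compact_space (subtopology (Euclidean_space n) W)"
      using VW(3) by (simp add: Hausdorff_Euclidean_space locally_compact_Euclidean_space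
          locally_compact_space_open_subset)
    then have "locally_compact_space (subtopology M V)"
      using VW(4) homeomorphic_locally_compact_space by blast
    moreover have "p \<in> topspace (subtopology M V)"
      using VW openin_subset by fastforce
    ultimately obtain G K where "openin (subtopology M V) G" "compactin (subtopology M V) K" "p \<in> G" "G \<subseteq> K"
      unfolding locally_compact_space_def by blast
    then show "\<exists>G K. openin M G \<and> compactin M K \<and> p \<in> G \<and> G \<subseteq> K"
      using VW(1) compactin_subtopology openin_open_subtopology by metis
  qed
  ultimately show ?thesis
    using haus Urysohn_metrization locally_compact_Hausdorff_imp_regular_space by blast
qed

section \<open>Flows\<close>

lemma flow_orbit_continuous:
  assumes "flow M f" "p \<in> topspace M"
  shows "continuous_map euclideanreal M (\<lambda>t. f t p)"
proof -
  have "continuous_map euclideanreal (prod_topology euclideanreal M) (\<lambda>t. (t, p))"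
    using assms(2) by (simp add: continuous_map_pairedI)
  moreover have "continuous_map (prod_topology euclideanreal M) M (\<lambda>(t, x). f t x)"
    using assms(1) by (simp add: flow_def)
  ultimately show ?thesis
    using continuous_map_compose[of _ "prod_topology euclideanreal M" "(\<lambda>t. (t, p))" M "\<lambda>(t, x). f t x"]
    by (simp add: o_def)
qed

lemma flow_time_continuous:
  assumes "flow M f"
  shows "continuous_map M M (f t)"
proof -
  have "continuous_map M (prod_topology euclideanreal M) (\<lambda>x. (t, x))"
    by (simp add: continuous_map_pairedI)
  moreover have "continuous_map (prod_topology euclideanreal M) M (\<lambda>(t, x). f t x)"
    using assms(1) by (simp add: flow_def)
  ultimately show ?thesis
    using continuous_map_compose[of _ "prod_topology euclideanreal M" "(\<lambda>x. (t, x))" M "\<lambda>(t, x). f t x"]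
    by (simp add: o_def)
qed

lemma flow_in_topspace: "flow M f \<Longrightarrow> x \<in> topspace M \<Longrightarrow> f t x \<in> topspace M"
  using flow_time_continuous[of M f t] by (auto simp: continuous_map_def)

lemma flow_zero: "flow M f \<Longrightarrow> x \<in> topspace M \<Longrightarrow> f 0 x = x"
  by (simp add: flow_def)

lemma flow_add: "flow M f \<Longrightarrow> x \<in> topspace M \<Longrightarrow> f s (f t x) = f (s + t) x"
  by (simp add: flow_def)

text \<open>Flowing for time \<open>- s\<close> from the common position turns a coincidence on the
  orbit into a period.\<close>

lemma flow_collision_period:
  assumes "flow M f" "p \<in> topspace M" "f r p = f s p"
  shows "f (r - s) p = p"
proof -
  have "f (r - s) p = f (- s) (f r p)"
    by (simp add: flow_add[OF assms(1,2)])
  also have "\<dots> = f (- s) (f s p)"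
    by (simp add: assms(3))
  finally show ?thesis
    by (simp add: flow_add[OF assms(1,2)] flow_zero[OF assms(1,2)])
qed

text \<open>Integer multiples of periods are periods, so arbitrarily small periods make the set of
  periods dense in the reals. It is also closed, because \<open>M\<close> is Hausdorff, hence it
  contains every time.\<close>

lemma flow_small_periods_imp_fixed:
  assumes fl: "flow M f" and haus: "Hausdorff_space M" and p: "p \<in> topspace M"
    and per: "\<And>e. e > 0 \<Longrightarrow> \<exists>u. 0 < u \<and> u < e \<and> f u p = p"
  shows "f t p = p"
proof -
  have mult: "f (of_nat n * u) p = p" if "f u p = p" for n u
  proof (induction n)
    case 0
    then show ?case by (simp add: flow_zero[OF fl p])
  next
    case (Suc n)
    have "f (of_nat (Suc n) * u) p = f (of_nat n * u) (f u p)"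
      by (simp add: flow_add[OF fl p] algebra_simps)
    then show ?case by (simp add: that Suc)
  qed
  have mult': "f (of_int n * u) p = p" if "f u p = p" for n u
  proof (cases "n \<ge> 0")
    case True
    then show ?thesis using mult[OF that, of "nat n"] by simp
  next
    case False
    \<comment> \<open>Negative multiples arise from the collision of time 0 with a positive
      multiple.\<close>
    have "f (0 - of_nat (nat (- n)) * u) p = p"
      using mult[OF that] flow_zero[OF fl p] by (intro flow_collision_period[OF fl p]) simp
    then show ?thesis using False by simp
  qed
  have "closedin euclideanreal {s \<in> topspace euclideanreal. f s p = p}"
    using flow_orbit_continuous[OF fl p] p haus
    by (intro closedin_continuous_maps_eq[of M]) auto
  then have "closed {s. f s p = p}" by simp
  moreover have "t \<in> closure {s. f s p = p}"
    unfolding closure_approachable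
  proof (intro allI impI)
    fix e :: real assume "e > 0"
    then obtain u where u: "0 < u" "u < e" "f u p = p" using per by blast
    \<comment> \<open>Rounding \<open>t\<close> down to a multiple of \<open>u\<close> costs less
      than \<open>u\<close>, hence less than \<open>e\<close>.\<close>
    have "of_int \<lfloor>t / u\<rfloor> * u \<le> t" "t < (of_int \<lfloor>t / u\<rfloor> + 1) * u"
      using u(1) by (simp_all flip: pos_le_divide_eq pos_divide_less_eq)
    then have "dist (of_int \<lfloor>t / u\<rfloor> * u) t < e"
      using u by (auto simp: dist_real_def algebra_simps)
    then show "\<exists>y\<in>{s. f s p = p}. dist y t < e"
      using mult'[OF u(3)] by blast
  qed
  ultimately show ?thesis by (simp add: closure_closed)
qed

text \<open>When \<open>h\<close> has a minimum at 0, the past and the future branch both climb from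
  \<open>h 0\<close>, so some level is attained on each. A maximum is handled by passing to
  \<open>- h\<close>.\<close>

lemma one_sided_collision:
  fixes h :: "real \<Rightarrow> real"
  assumes cont: "continuous_on {-e..e} h" and e: "0 < e"
    and sided: "(\<forall>s\<in>{-e..e}. h 0 \<le> h s) \<or> (\<forall>s\<in>{-e..e}. h s \<le> h 0)"
  shows "\<exists>r\<in>{-e..e}. \<exists>s\<in>{-e..e}. s < r \<and> h r = h s"
proof -
  have pos: "\<exists>r\<in>{-e..e}. \<exists>s\<in>{-e..e}. s < r \<and> g r = g s"
    if g: "continuous_on {-e..e} g" and ge: "\<forall>s\<in>{-e..e}. g 0 \<le> g s" for g :: "real \<Rightarrow> real"
  proof -
    \<comment> \<open>The lower of the two end values lies between \<open>g 0\<close> and either end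
      value, so the intermediate value theorem finds it on both branches.\<close>
    define c where "c = min (g e) (g (- e))"
    have c: "g 0 \<le> c" using ge e by (simp add: c_def)
    have "\<exists>r. 0 \<le> r \<and> r \<le> e \<and> g r = c"
      using c e by (intro IVT' continuous_on_subset[OF g]) (auto simp: c_def)
    moreover have "\<exists>s. - e \<le> s \<and> s \<le> 0 \<and> g s = c"
      using c e by (intro IVT2' continuous_on_subset[OF g]) (auto simp: c_def)
    ultimately obtain r s where rs: "0 \<le> r" "r \<le> e" "g r = c" "- e \<le> s" "s \<le> 0" "g s = c"
      by blast
    show ?thesis
    proof (cases "s < r")
      case True
      then show ?thesis using rs by (intro bexI[of _ r] bexI[of _ s]) auto
    next
      \<comment> \<open>Both times found are then 0, so \<open>c = g 0\<close>. The end of the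
        interval where the minimum \<open>c\<close> is taken collides with time 0 instead.\<close>
      case False
      then have "r = 0" using rs by linarith
      then have "g 0 = c" using rs by simp
      then have "g e = g 0 \<or> g (- e) = g 0" by (auto simp: c_def min_def split: if_splits)
      then consider "g e = g 0" | "g 0 = g (- e)" by auto
      then show ?thesis
      proof cases
        case 1
        then show ?thesis using e by (intro bexI[of _ e] bexI[of _ 0]) auto
      next
        case 2
        then show ?thesis using e by (intro bexI[of _ 0] bexI[of _ "- e"]) auto
      qed
    qed
  qed
  show ?thesis
    using sided
  proof
    assume "\<forall>s\<in>{-e..e}. h 0 \<le> h s"
    then show ?thesis using pos[OF cont] by blast
  next
    assume "\<forall>s\<in>{-e..e}. h s \<le> h 0"
    then show ?thesis using pos[of "\<lambda>s. - h s"] cont by (auto intro: continuous_intros)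
  qed
qed

text \<open>If \<open>p\<close> is an end of its own orbit, a short arc of the orbit through \<open>p\<close> stays on one side of
  \<open>p\<close> in the chart, so by the intermediate value theorem its past and its future collide; the
  collision yields a period as short as the arc.\<close>

lemma orbit_end_is_fixed:
  assumes fl: "flow M f" and haus: "Hausdorff_space M"
    and chart: "half_line_chart (subtopology M S) V \<phi>" and pV: "p \<in> V"
    and orb: "\<And>t. f t p \<in> S"
    and ends: "\<phi> p = 0 \<or> p \<notin> (subtopology M S) interior_of (range (\<lambda>t. f t p))"
  shows "f t p = p"
proof -
  define N where "N = subtopology M S"
  obtain W where oV: "openin N V" and oW: "openin (top_of_set {0..}) W"
    and hom: "homeomorphic_map (subtopology N V) (top_of_set W) \<phi>"
    using chart unfolding half_line_chart_def N_def by blast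
  have VN: "V \<subseteq> topspace N" using oV openin_subset by blast
  then have p: "p \<in> topspace M" using pV by (auto simp: N_def)
  have topV: "topspace (subtopology N V) = V" using VN by auto
  have injV: "inj_on \<phi> V" and imV: "\<phi> ` V = W"
    using homeomorphic_imp_injective_map[OF hom] homeomorphic_imp_surjective_map[OF hom] topV by auto
  have W0: "W \<subseteq> {0..}" using openin_subset[OF oW] by simp
  define c where "c = (\<lambda>s. f s p)"
  have cN: "continuous_map euclideanreal N c"
    using flow_orbit_continuous[OF fl p] orb by (auto simp: c_def N_def continuous_map_in_subtopology)
  have c0: "c 0 = p" by (simp add: c_def flow_zero[OF fl p])
  have "openin euclideanreal {s \<in> topspace euclideanreal. c s \<in> V}"
    by (rule openin_continuous_map_preimage[OF cN oV])
  then have "open {s. c s \<in> V}" by simp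
  then obtain d0 where d0: "d0 > 0" "cball 0 d0 \<subseteq> {s. c s \<in> V}"
    using c0 pV open_contains_cball by (metis mem_Collect_eq)
  show ?thesis
  proof (rule flow_small_periods_imp_fixed[OF fl haus p])
    fix e0 :: real assume "e0 > 0"
    \<comment> \<open>The bound \<open>d0\<close> keeps the arc inside the chart. Two times in the
      arc differ by at most \<open>2 * e\<close>, so a collision gives a period below
      \<open>e0\<close>.\<close>
    define e where "e = min d0 (e0 / 3)"
    have e: "e > 0" "e \<le> d0" "2 * e < e0" using d0 \<open>e0 > 0\<close> by (auto simp: e_def)
    have inV: "c s \<in> V" if "s \<in> {-e..e}" for s
      using that d0 e by (auto simp: subset_iff dist_real_def)
    define h where "h = (\<lambda>s. \<phi> (c s))"
    have "continuous_map (top_of_set {-e..e}) (subtopology N V) c"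
      using inV cN by (auto simp: continuous_map_in_subtopology continuous_map_from_subtopology)
    from continuous_map_compose[OF this homeomorphic_imp_continuous_map[OF hom]]
    have "continuous_map (top_of_set {-e..e}) (top_of_set W) h"
      by (simp only: h_def o_def)
    then have hc: "continuous_on {-e..e} h" and hW: "\<And>s. s \<in> {-e..e} \<Longrightarrow> h s \<in> W"
      by (auto simp: continuous_map_in_subtopology)
    have h0: "h 0 = \<phi> p" by (simp add: h_def c0)
    \<comment> \<open>If the arc took values on both sides of \<open>h 0\<close>, then
      \<open>\<phi> p\<close> would be positive, as the chart has no negative values. By
      connectedness the arc would also cover a chart interval around \<open>\<phi> p\<close>,
      putting \<open>p\<close> in the interior of its orbit. Together these contradict
      \<open>ends\<close>.\<close>
    have "(\<forall>s\<in>{-e..e}. h 0 \<le> h s) \<or> (\<forall>s\<in>{-e..e}. h s \<le> h 0)"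
    proof (rule ccontr)
      assume "\<not> ?thesis"
      then obtain a b where ab: "a \<in> {-e..e}" "b \<in> {-e..e}" "h a < h 0" "h 0 < h b"
        by (auto simp: not_le)
      then have "0 < \<phi> p" using hW[of a] W0 h0 by force
      have "connected (h ` {-e..e})"
        using hc by (intro connected_continuous_image) auto
      then have sub: "{h a..h b} \<subseteq> h ` {-e..e}"
        using ab by (intro connected_contains_Icc) auto
      define G where "G = {q \<in> topspace (subtopology N V). \<phi> q \<in> {h a<..<h b} \<inter> W}"
      have "openin (subtopology N V) G"
        unfolding G_def
        by (rule openin_continuous_map_preimage[OF homeomorphic_imp_continuous_map[OF hom]])
           (auto simp: openin_open)
      then have "openin N G" using oV openin_open_subtopology by blast
      moreover have "p \<in> G" using pV topV imV ab h0 by (auto simp: G_def)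
      moreover have "G \<subseteq> range c"
      proof
        fix q assume q: "q \<in> G"
        then have "\<phi> q \<in> h ` {-e..e}"
          using sub by (intro subsetD[OF sub]) (auto simp: G_def)
        then obtain s where s: "s \<in> {-e..e}" "\<phi> q = h s" by blast
        have "q = c s"
          using q s inV[OF s(1)] topV by (intro inj_onD[OF injV]) (simp_all add: h_def G_def)
        then show "q \<in> range c" by blast
      qed
      ultimately have "p \<in> N interior_of range c" by (auto simp: interior_of_def)
      then show False using ends \<open>0 < \<phi> p\<close> by (simp add: N_def c_def)
    qed
    then obtain r s where rs: "r \<in> {-e..e}" "s \<in> {-e..e}" "s < r" "h r = h s"
      using one_sided_collision[OF hc e(1)] by blast
    then have "c r = c s" using inV injV by (auto simp: h_def inj_on_def)
    then have "f (r - s) p = p" using flow_collision_period[OF fl p] by (simp add: c_def)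
    then show "\<exists>u>0. u < e0 \<and> f u p = p"
      using rs e by (intro exI[of _ "r - s"]) auto
  qed
qed

section \<open>Orbits that meet the core and orbits that avoid it\<close>

lemma Lindelof_orbit_saturation:
  assumes fl: "flow M f" and U: "openin M U" and lin: "Lindelof_space (subtopology M U)"
  shows "Lindelof_space (subtopology M (\<Union>t. f t ` U))"
proof -
  have UM: "U \<subseteq> topspace M" using U openin_subset by blast
  have "f t u \<in> (\<Union>q\<in>\<rat>. f q ` U)" if uU: "u \<in> U" for t u
  proof -
    have u: "u \<in> topspace M" using uU UM by blast
    \<comment> \<open>Since \<open>U\<close> is open, \<open>u\<close> stays in it for short times
      in both directions. The time \<open>t\<close> can thus be split into a rational
      \<open>q\<close> and a small remainder that is absorbed by moving \<open>u\<close> within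
      \<open>U\<close>.\<close>
    have "openin euclideanreal {s \<in> topspace euclideanreal. f s u \<in> U}"
      by (rule openin_continuous_map_preimage[OF flow_orbit_continuous[OF fl u] U])
    then have "open {s. f s u \<in> U}" by simp
    then obtain d where d: "d > 0" "cball 0 d \<subseteq> {s. f s u \<in> U}"
      using flow_zero[OF fl u] uU open_contains_cball by (metis mem_Collect_eq)
    obtain q where q: "q \<in> \<rat>" "t < q" "q < t + d"
      using Rats_dense_in_real[of t "t + d"] d(1) by auto
    then have "t - q \<in> cball 0 d" by (simp add: dist_real_def)
    then have "f (t - q) u \<in> U" using d(2) by blast
    moreover have "f t u = f q (f (t - q) u)" by (simp add: flow_add[OF fl u])
    ultimately show ?thesis using q by blast
  qed
  then have eq: "(\<Union>t. f t ` U) = \<Union> ((\<lambda>q. f q ` U) ` \<rat>)" by blast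
  show ?thesis
    unfolding eq
  proof (rule Lindelof_space_Union)
    show "countable ((\<lambda>q. f q ` U) ` \<rat>)" by (simp add: countable_rat)
    fix A assume "A \<in> (\<lambda>q. f q ` U) ` \<rat>"
    then obtain q where A: "A = f q ` U" by blast
    have "continuous_map (subtopology M U) (subtopology M A) (f q)"
      using flow_time_continuous[OF fl] by (auto simp: A continuous_map_in_subtopology continuous_map_from_subtopology)
    then show "Lindelof_space (subtopology M A)"
      using UM flow_in_topspace[OF fl] by (intro Lindelof_space_continuous_map_image[OF lin]) (auto simp: A)
  qed
qed

theorem theorem3p11:
  fixes M :: "'a topology" and U X :: "'a set" and T :: "'a \<Rightarrow> 'a set"
  assumes "manifold M"
    and "\<not> metrizable_space M"
    and "cytoplasmic_decomposition M U X T"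
  shows "\<nexists>f. brush M f"
proof
  assume "\<exists>f. brush M f"
  then obtain f where fl: "flow M f" and nst: "\<And>x. \<not> stationary_point M f x"
    unfolding brush_def by blast
  have haus: "Hausdorff_space M" using assms(1) by (simp add: manifold_def)
  have oU: "openin M U" and lin: "Lindelof_space (subtopology M U)"
    and bij: "bij_betw T X (connected_components_of (subtopology M (topspace M - U)))"
    and thorn: "\<And>x. x \<in> X \<Longrightarrow> one_manifold_with_boundary (subtopology M (T x)) \<and>
            boundary_points (subtopology M (T x)) = {x}"
    using assms(3) unfolding cytoplasmic_decomposition_def by blast+
  have UM: "U \<subseteq> topspace M" using oU openin_subset by blast
  define S where "S = (\<Union>t. f t ` U)"
  have SM: "S \<subseteq> topspace M" using UM flow_in_topspace[OF fl] by (auto simp: S_def)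
  have US: "U \<subseteq> S"
  proof
    fix u assume "u \<in> U"
    then have "u = f 0 u" using UM flow_zero[OF fl] by auto
    then show "u \<in> S" using \<open>u \<in> U\<close> by (auto simp: S_def)
  qed
  \<comment> \<open>Used in contrapositive form: an orbit that starts outside \<open>S\<close> never
    enters it.\<close>
  have S_back: "y \<in> S" if y: "y \<in> topspace M" and fS: "f t y \<in> S" for t y
  proof -
    obtain s u where "u \<in> U" and su: "f t y = f s u"
      using fS unfolding S_def by blast
    then have u: "u \<in> topspace M" using UM by blast
    have "y = f (- t) (f t y)" by (simp add: flow_add[OF fl y] flow_zero[OF fl y])
    also have "\<dots> = f (- t + s) u" by (simp add: su flow_add[OF fl u])
    finally show ?thesis using \<open>u \<in> U\<close> by (auto simp: S_def)
  qed
  have oS: "openin M S"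
  proof -
    have "openin M (f t ` U)" for t
    proof -
      \<comment> \<open>The image is rewritten as a preimage under the inverse map
        \<open>f (- t)\<close>, so continuity shows that it is open.\<close>
      have "f t ` U = {y \<in> topspace M. f (- t) y \<in> U}"
      proof (intro equalityI subsetI)
        fix y assume "y \<in> f t ` U"
        then obtain u where "u \<in> U" "y = f t u" by blast
        then show "y \<in> {y \<in> topspace M. f (- t) y \<in> U}"
          using UM by (auto simp: flow_add[OF fl] flow_zero[OF fl] flow_in_topspace[OF fl] subset_iff)
      next
        fix y assume y: "y \<in> {y \<in> topspace M. f (- t) y \<in> U}"
        then have "y = f t (f (- t) y)" by (simp add: flow_add[OF fl] flow_zero[OF fl])
        then show "y \<in> f t ` U" using y by blast
      qed
      then show ?thesis
        using openin_continuous_map_preimage[OF flow_time_continuous[OF fl] oU] by simp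
    qed
    then show ?thesis by (auto simp: S_def)
  qed
  \<comment> \<open>Otherwise \<open>M\<close> itself would be Lindelof, hence metrizable.\<close>
  have "S \<noteq> topspace M"
    using Lindelof_orbit_saturation[OF fl oU lin] Lindelof_manifold_metrizable[OF assms(1)] assms(2)
    by (auto simp flip: S_def)
  then obtain z where z: "z \<in> topspace M" "z \<notin> S" using SM by blast
  define C where "C = subtopology M (topspace M - U)"
  have "z \<in> topspace C" using z US by (auto simp: C_def)
  then have "z \<in> \<Union> (connected_components_of C)" by (simp add: Union_connected_components_of)
  then obtain x where x: "x \<in> X" "z \<in> T x" "T x \<in> connected_components_of C"
    using bij unfolding C_def bij_betw_def by blast
  define N where "N = subtopology M (T x)"
  have TM: "T x \<subseteq> topspace M"
    using connected_components_of_subset[OF x(3)] by (auto simp: C_def)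
  have topN: "topspace N = T x" using TM by (auto simp: N_def)
  define K where "K = T x - S"
  have inv: "f t y \<in> K" if "y \<in> K" for t y
  proof -
    have y: "y \<in> topspace M" "y \<in> T x" "y \<notin> S" using that TM by (auto simp: K_def)
    have orbS: "f s y \<in> topspace M - S" for s
      using S_back[of y s] y flow_in_topspace[OF fl] by blast
    \<comment> \<open>The orbit of \<open>y\<close> avoids \<open>S\<close> and with it the core, so
      it is a connected subset of \<open>C\<close> and lies in the component \<open>T x\<close>
      containing \<open>y\<close>.\<close>
    have "continuous_map euclideanreal C (\<lambda>s. f s y)"
      using flow_orbit_continuous[OF fl y(1)] orbS US by (auto simp: C_def continuous_map_in_subtopology)
    then have "connectedin C (range (\<lambda>s. f s y))"
      using connectedin_continuous_map_image[of euclideanreal C _ UNIV] by simp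
    moreover have "y \<in> range (\<lambda>s. f s y)" using flow_zero[OF fl y(1)] by (metis rangeI)
    ultimately have "range (\<lambda>s. f s y) \<subseteq> T x"
      using connected_components_of_maximal[OF x(3)] y by (metis disjnt_iff)
    then show ?thesis using orbS by (auto simp: K_def)
  qed
  have "\<exists>p V \<phi>. p \<in> K \<and> p \<in> V \<and> half_line_chart N V \<phi> \<and>
      (\<phi> p = 0 \<or> p \<notin> N interior_of range (\<lambda>t. f t p))"
  proof (cases "K = T x")
    case True
    obtain V \<phi> where V: "x \<in> V" "half_line_chart N V \<phi>" "\<phi> x = 0"
      using thorn[OF x(1)] unfolding N_def boundary_points_def by blast
    then have "x \<in> K"
      using True topN openin_subset unfolding half_line_chart_def by blast
    then show ?thesis using V by blast
  next
    case False
    \<comment> \<open>\<open>K\<close> is a nonempty proper closed subset of the connected thorn,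
      hence not open. This provides a point of \<open>K\<close> outside its interior.\<close>
    have "closedin N K"
      using oS TM by (auto simp: N_def K_def closedin_def topN[unfolded N_def] openin_subtopology Diff_Diff_Int)
    moreover have "connected_space N"
      using thorn[OF x(1)] by (simp add: one_manifold_with_boundary_def N_def)
    moreover have "K \<noteq> {}" using x z by (auto simp: K_def)
    ultimately have "\<not> openin N K"
      using False topN by (metis connected_space_clopen_in)
    then obtain p where p: "p \<in> K" "p \<notin> N interior_of K"
      by (metis interior_of_eq interior_of_subset subsetI subset_antisym)
    obtain V \<phi> where "p \<in> V" "half_line_chart N V \<phi>"
      using thorn[OF x(1)] p(1) topN unfolding one_manifold_with_boundary_def N_def K_def by blast
    \<comment> \<open>By invariance the orbit of \<open>p\<close> lies in \<open>K\<close>, so a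
      point not interior to \<open>K\<close> is not interior to its orbit either.\<close>
    moreover have "p \<notin> N interior_of range (\<lambda>t. f t p)"
      using p inv by (meson image_subsetI interior_of_mono subsetD)
    ultimately show ?thesis using p by blast
  qed
  then obtain p V \<phi> where p: "p \<in> K" "p \<in> V" "half_line_chart N V \<phi>"
    "\<phi> p = 0 \<or> p \<notin> N interior_of range (\<lambda>t. f t p)" by blast
  have "f t p \<in> T x" for t using inv[OF p(1)] by (auto simp: K_def)
  then have "f t p = p" for t
    using orbit_end_is_fixed[OF fl haus, of "T x" V \<phi> p] p(2-4) unfolding N_def by blast
  then have "stationary_point M f p"
    using p(1) TM by (auto simp: stationary_point_def K_def)
  then show False using nst by blast
qed

end
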